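(* Let $P_{\mathrm{queen}}(t)=\sum_{n\ge 0}p_{\mathrm{queen},n}t^n$, where $p_{\mathrm{queen},n}$ is the number of Catalan queen paths from $(0,0)$ to $(n,n)$. Then, as formal power series, $$P_{\mathrm{queen}}(t)=\frac{(1-t)(1+t-4t^2)-(1-t)^2\sqrt{1-12t+16t^2}}{2t(2-3t)^2}.$$
   Context: A lattice path with step set $S\subseteq\mathbb{N}\times\mathbb{N}$ from $(0,0)$ to $(n,m)$ is a finite (possibly empty) sequence of steps in $S$ summing to $(n,m)$; its nodes are $(0,0)$ and the points reached after each step. The path is Catalan if every node $(x,y)$ satisfies $x<y+1$, i.e. $x\le y$. A queen path is a path with step set $S=\{(a,0),(0,a):a>0\}\cup\{(a,a):a>0\}$, $a$ an integer. The square root is the power series square root with constant term $1$. *)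

theory Defs
  imports
    Complex_Main
    "HOL-Library.Product_Plus"
    "HOL-Computational_Algebra.Formal_Laurent_Series"
begin

text \<open>A path is represented by its list of steps; the start is always the origin.\<close>

definition lattice_path :: "(nat \<times> nat) set \<Rightarrow> nat \<times> nat \<Rightarrow> (nat \<times> nat) list \<Rightarrow> bool" where
  "lattice_path S p ss \<longleftrightarrow> set ss \<subseteq> S \<and> sum_list ss = p"

definition path_nodes :: "(nat \<times> nat) list \<Rightarrow> (nat \<times> nat) set" where
  "path_nodes ss = {sum_list (take k ss) | k. k \<le> length ss}"

definition catalan_path :: "(nat \<times> nat) list \<Rightarrow> bool" where
  "catalan_path ss \<longleftrightarrow> (\<forall>(x, y) \<in> path_nodes ss. x < y + 1)"

definition queen_steps :: "(nat \<times> nat) set" where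
  "queen_steps = {(a, 0) | a. a > 0} \<union> {(0, a) | a. a > 0} \<union> {(a, a) | a. a > 0}"

definition catalan_queen_paths :: "nat \<Rightarrow> (nat \<times> nat) list set" where
  "catalan_queen_paths n = {ss. lattice_path queen_steps (n, n) ss \<and> catalan_path ss}"

definition p_queen :: "nat \<Rightarrow> nat" where
  "p_queen n = card (catalan_queen_paths n)"

definition P_queen :: "real fps" where
  "P_queen = Abs_fps (\<lambda>n. of_nat (p_queen n))"

text \<open>The set being counted is finite, so \<^const>\<open>card\<close> is a genuine count.\<close>

lemma queen_path_bounds:
  assumes "set ss \<subseteq> queen_steps"
  shows "length ss \<le> fst (sum_list ss) + snd (sum_list ss) \<and>
    set ss \<subseteq> {..fst (sum_list ss)} \<times> {..snd (sum_list ss)}"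
  using assms
proof (induction ss)
  case Nil
  then show ?case by simp
next
  case (Cons s ss)
  have "fst s + snd s \<ge> 1" using Cons.prems by (auto simp: queen_steps_def)
  moreover have "length ss \<le> fst (sum_list ss) + snd (sum_list ss)"
    and "set ss \<subseteq> {..fst (sum_list ss)} \<times> {..snd (sum_list ss)}"
    using Cons by auto
  ultimately show ?case by (cases s) fastforce
qed

lemma finite_catalan_queen_paths: "finite (catalan_queen_paths n)"
proof (rule finite_subset)
  show "catalan_queen_paths n \<subseteq> {ss. set ss \<subseteq> {..n} \<times> {..n} \<and> length ss \<le> n + n}"
    using queen_path_bounds by (fastforce simp: catalan_queen_paths_def lattice_path_def)
  show "finite {ss :: (nat \<times> nat) list. set ss \<subseteq> {..n} \<times> {..n} \<and> length ss \<le> n + n}"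
    by (intro finite_lists_length_le) auto
qed

text \<open>The square root with constant term 1 is the library's \<^const>\<open>fps_radical\<close>, for
  the real root function \<^const>\<open>root\<close> on the constant term.\<close>

definition fps_sqrt :: "real fps \<Rightarrow> real fps" where
  "fps_sqrt f = fps_radical root 2 f"

lemma fps_sqrt_nth_0:
  assumes "f $ 0 = 1"
  shows "fps_sqrt f $ 0 = 1"
  using assms by (simp add: fps_sqrt_def)

lemma fps_sqrt_power2:
  assumes "f $ 0 = 1"
  shows "fps_sqrt f ^ 2 = f"
  using power_radical[of f root 1] assms by (simp add: fps_sqrt_def numeral_2_eq_2)

end

theory Submission
  imports Defs
begin

text \<open>Let \<open>F\<^sub>h\<close> count the Catalan queen paths ending at height \<open>y - x = h\<close>, with \<open>t\<close> marking \<open>x\<close>.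
  Removing the last step gives
  \<open>F\<^sub>h = [h = 0] + t/(1-t) F\<^sub>h + (\<Sum>j<h. F\<^sub>j) + (\<Sum>k>h. t^(k-h) F\<^sub>k)\<close>,
  a system that determines all coefficients recursively. It is solved by \<open>F\<^sub>0 = P\<close> and
  \<open>F\<^sub>h = P (r - 1) r^(h-1)\<close> for \<open>h > 0\<close>, where \<open>r\<close> is the power series root of
  \<open>t (2 - 3t) r\<^sup>2 - (1 + t - 4t\<^sup>2) r + (2 - 3t) = 0\<close> and \<open>P = (1 - t) r / (2 - 3t)\<close>.\<close>

section \<open>Decomposition at the last step\<close>

text \<open>The endpoint is given by \<open>x\<close> and its height \<open>h\<close> above the
  diagonal. Every Catalan path ends at some height \<open>h \<ge> 0\<close>, and
  \<open>h = 0\<close> gives \<open>catalan_queen_paths\<close>.\<close>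

definition queen_paths_at :: "nat \<Rightarrow> nat \<Rightarrow> (nat \<times> nat) list set" where
  "queen_paths_at h x = {ss. lattice_path queen_steps (x, x + h) ss \<and> catalan_path ss}"

lemma path_nodes_Nil: "path_nodes [] = {(0, 0)}"
  by (simp add: path_nodes_def zero_prod_def)

lemma path_nodes_snoc: "path_nodes (ss @ [s]) = insert (sum_list ss + s) (path_nodes ss)"
proof -
  have "path_nodes (ss @ [s]) = (\<lambda>k. sum_list (take k (ss @ [s]))) ` {..Suc (length ss)}"
    by (auto simp: path_nodes_def)
  also have "\<dots> = insert (sum_list ss + s) ((\<lambda>k. sum_list (take k ss)) ` {..length ss})"
    by (simp add: atMost_Suc cong: image_cong_simp)
  also have "(\<lambda>k. sum_list (take k ss)) ` {..length ss} = path_nodes ss"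
    by (auto simp: path_nodes_def)
  finally show ?thesis .
qed

lemma catalan_path_Nil: "catalan_path []"
  by (simp add: catalan_path_def path_nodes_Nil)

lemma catalan_path_snoc:
  "catalan_path (ss @ [s]) \<longleftrightarrow> catalan_path ss \<and> fst (sum_list ss + s) \<le> snd (sum_list ss + s)"
  by (auto simp: catalan_path_def path_nodes_snoc case_prod_beta less_Suc_eq_le)

lemma catalan_path_end: "catalan_path ss \<Longrightarrow> fst (sum_list ss) \<le> snd (sum_list ss)"
  by (cases ss rule: rev_cases) (auto simp: catalan_path_snoc)

lemma finite_queen_paths_at: "finite (queen_paths_at h x)"
proof (rule finite_subset)
  show "queen_paths_at h x \<subseteq> {ss. set ss \<subseteq> {..x} \<times> {..x + h} \<and> length ss \<le> x + (x + h)}"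
    using queen_path_bounds by (fastforce simp: queen_paths_at_def lattice_path_def)
  show "finite {ss :: (nat \<times> nat) list. set ss \<subseteq> {..x} \<times> {..x + h} \<and> length ss \<le> x + (x + h)}"
    by (intro finite_lists_length_le) auto
qed

text \<open>The last step starts at \<open>(x - a, x + h - b)\<close>, which has height
  \<open>h + a - b\<close>. The Catalan condition at that node is \<open>b \<le> h + a\<close>, so
  the subtraction is not truncated. At the endpoint the condition holds because \<open>h\<close> is
  natural.\<close>

lemma queen_paths_at_snoc:
  "ss @ [(a, b)] \<in> queen_paths_at h x \<longleftrightarrow>
    (a, b) \<in> queen_steps \<and> a \<le> x \<and> b \<le> h + a \<and>
      ss \<in> queen_paths_at (h + a - b) (x - a)" (is "?L \<longleftrightarrow> ?R")
proof
  assume L: ?L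
  obtain u v where uv: "sum_list ss = (u, v)" by fastforce
  have "u \<le> v" using L catalan_path_end[of ss] uv
    by (auto simp: queen_paths_at_def catalan_path_snoc)
  moreover have "u + a = x" "v + b = x + h"
    using L uv by (auto simp: queen_paths_at_def lattice_path_def)
  moreover from calculation have "v = x - a + (h + a - b)" "b \<le> h + a"
    by linarith+
  ultimately show ?R
    using L uv by (auto simp: queen_paths_at_def lattice_path_def catalan_path_snoc)
next
  assume ?R
  then show ?L by (auto simp: queen_paths_at_def lattice_path_def catalan_path_snoc)
qed

lemma queen_paths_at_Nil: "[] \<in> queen_paths_at h x \<longleftrightarrow> h = 0 \<and> x = 0"
  by (auto simp: queen_paths_at_def lattice_path_def catalan_path_Nil zero_prod_def)

text \<open>Translates between indexing by the start \<open>i\<close> of the last step and by its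
  length \<open>c = n - i\<close>.\<close>

lemma snoc_in_UN_iff:
  fixes n :: nat
  shows "ss @ [s] \<in> (\<Union>i<n. (\<lambda>ss. ss @ [g (n - i)]) ` A i) \<longleftrightarrow>
    (\<exists>c. 0 < c \<and> c \<le> n \<and> s = g c \<and> ss \<in> A (n - c))" (is "?L \<longleftrightarrow> ?R")
proof
  assume ?L
  then obtain i where "i < n" "s = g (n - i)" "ss \<in> A i" by auto
  then show ?R by (intro exI[of _ "n - i"]) auto
next
  assume ?R
  then obtain c where "0 < c" "c \<le> n" "s = g c" "ss \<in> A (n - c)" by auto
  then show ?L by (intro UN_I[of "n - c"]) auto
qed

lemma queen_paths_at_decomp:
  "queen_paths_at h x =
    (if h = 0 \<and> x = 0 then {[]} else {}) \<union>
    ((\<Union>i<x. (\<lambda>ss. ss @ [(x - i, 0)]) ` queen_paths_at (h + x - i) i) \<union>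
     ((\<Union>j<h. (\<lambda>ss. ss @ [(0, h - j)]) ` queen_paths_at j x) \<union>
      (\<Union>i<x. (\<lambda>ss. ss @ [(x - i, x - i)]) ` queen_paths_at h i)))" (is "_ = ?R")
proof (rule set_eqI)
  fix ws
  show "ws \<in> queen_paths_at h x \<longleftrightarrow> ws \<in> ?R"
  proof (cases ws rule: rev_cases)
    case Nil
    then show ?thesis by (auto simp: queen_paths_at_Nil)
  next
    case (snoc ss s)
    obtain a b where s: "s = (a, b)" by fastforce
    have "ws \<in> queen_paths_at h x \<longleftrightarrow> (a, b) \<in> queen_steps \<and> a \<le> x \<and> b \<le> h + a \<and>
        ss \<in> queen_paths_at (h + a - b) (x - a)"
      by (simp only: snoc s queen_paths_at_snoc)
    \<comment> \<open>Horizontal, vertical and diagonal last steps. The height \<open>h + a\<close>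
      is written \<open>h + x - (x - a)\<close> to match the index \<open>i = x - a\<close> of the
      union.\<close>
    also have "\<dots> \<longleftrightarrow>
        (0 < a \<and> a \<le> x \<and> b = 0 \<and> ss \<in> queen_paths_at (h + x - (x - a)) (x - a)) \<or>
        (0 < b \<and> b \<le> h \<and> a = 0 \<and> ss \<in> queen_paths_at (h - b) x) \<or>
        (0 < a \<and> a \<le> x \<and> b = a \<and> ss \<in> queen_paths_at h (x - a))"
      by (cases "a = 0"; cases "b = 0"; cases "a = b"; cases "a \<le> x") (simp_all add: queen_steps_def)
    also have "(0 < a \<and> a \<le> x \<and> b = 0 \<and> ss \<in> queen_paths_at (h + x - (x - a)) (x - a)) \<longleftrightarrow>
        ws \<in> (\<Union>i<x. (\<lambda>ss. ss @ [(x - i, 0)]) ` queen_paths_at (h + x - i) i)"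
      unfolding snoc snoc_in_UN_iff[where n = x and g = "\<lambda>c. (c, 0)" and A = "\<lambda>i. queen_paths_at (h + x - i) i"]
      by (auto simp: s)
    also have "(0 < b \<and> b \<le> h \<and> a = 0 \<and> ss \<in> queen_paths_at (h - b) x) \<longleftrightarrow>
        ws \<in> (\<Union>j<h. (\<lambda>ss. ss @ [(0, h - j)]) ` queen_paths_at j x)"
      unfolding snoc snoc_in_UN_iff[where n = h and g = "\<lambda>c. (0, c)" and A = "\<lambda>j. queen_paths_at j x"]
      by (auto simp: s)
    also have "(0 < a \<and> a \<le> x \<and> b = a \<and> ss \<in> queen_paths_at h (x - a)) \<longleftrightarrow>
        ws \<in> (\<Union>i<x. (\<lambda>ss. ss @ [(x - i, x - i)]) ` queen_paths_at h i)"
      unfolding snoc snoc_in_UN_iff[where n = x and g = "\<lambda>c. (c, c)" and A = "\<lambda>i. queen_paths_at h i"]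
      by (auto simp: s)
    finally show ?thesis by (simp add: snoc)
  qed
qed

section \<open>The counting recurrence and its uniqueness\<close>

lemma card_UN_snoc:
  assumes "finite I" "inj_on s I" "\<And>i. i \<in> I \<Longrightarrow> finite (A i)"
  shows "card (\<Union>i\<in>I. (\<lambda>ss. ss @ [s i]) ` A i) = (\<Sum>i\<in>I. card (A i))"
proof -
  have "card (\<Union>i\<in>I. (\<lambda>ss. ss @ [s i]) ` A i) = (\<Sum>i\<in>I. card ((\<lambda>ss. ss @ [s i]) ` A i))"
    using assms by (intro card_UN_disjoint) (auto dest: inj_onD)
  also have "\<dots> = (\<Sum>i\<in>I. card (A i))"
    by (intro sum.cong refl card_image) (auto simp: inj_on_def)
  finally show ?thesis .
qed

lemma card_queen_paths_at_rec:
  "card (queen_paths_at h x) =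
    (if h = 0 \<and> x = 0 then 1 else 0) +
    (\<Sum>i<x. card (queen_paths_at (h + x - i) i)) +
    (\<Sum>j<h. card (queen_paths_at j x)) +
    (\<Sum>i<x. card (queen_paths_at h i))"
proof -
  define N :: "(nat \<times> nat) list set" where "N = (if h = 0 \<and> x = 0 then {[]} else {})"
  define R where "R = (\<Union>i<x. (\<lambda>ss. ss @ [(x - i, 0::nat)]) ` queen_paths_at (h + x - i) i)"
  define U where "U = (\<Union>j<h. (\<lambda>ss. ss @ [(0::nat, h - j)]) ` queen_paths_at j x)"
  define D where "D = (\<Union>i<x. (\<lambda>ss. ss @ [(x - i, x - i)]) ` queen_paths_at h i)"
  have fin: "finite N" "finite R" "finite U" "finite D"
    by (auto simp: N_def R_def U_def D_def finite_queen_paths_at)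
  have "queen_paths_at h x = N \<union> (R \<union> (U \<union> D))"
    unfolding N_def R_def U_def D_def by (rule queen_paths_at_decomp)
  \<comment> \<open>Since \<open>i < x\<close> and \<open>j < h\<close>, the last steps have exactly
    the second, exactly the first, or neither coordinate zero, so no two families meet.\<close>
  moreover have "N \<inter> (R \<union> (U \<union> D)) = {}" "R \<inter> (U \<union> D) = {}" "U \<inter> D = {}"
    by (auto simp: N_def R_def U_def D_def)
  ultimately have "card (queen_paths_at h x) = card N + (card R + (card U + card D))"
    using fin by (simp add: card_Un_disjoint)
  moreover have "card N = (if h = 0 \<and> x = 0 then 1 else 0)"
    by (simp add: N_def)
  moreover have "card R = (\<Sum>i<x. card (queen_paths_at (h + x - i) i))"
    unfolding R_def by (intro card_UN_snoc) (auto simp: finite_queen_paths_at inj_on_def)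
  moreover have "card U = (\<Sum>j<h. card (queen_paths_at j x))"
    unfolding U_def by (intro card_UN_snoc) (auto simp: finite_queen_paths_at inj_on_def)
  moreover have "card D = (\<Sum>i<x. card (queen_paths_at h i))"
    unfolding D_def by (intro card_UN_snoc) (auto simp: finite_queen_paths_at inj_on_def)
  ultimately show ?thesis by simp
qed

text \<open>Every term on the right has a smaller value of \<open>h + 2 * x\<close>, so the
  recurrence has only one solution. The weight 2 is needed because a horizontal step of length
  \<open>c\<close> lowers \<open>x\<close> by \<open>c\<close> on removal but raises the height by
  \<open>c\<close>.\<close>

lemma card_queen_paths_at_unique:
  fixes G :: "nat \<Rightarrow> nat \<Rightarrow> 'a :: semiring_1"
  assumes "\<And>h x. G h x = (if h = 0 \<and> x = 0 then 1 else 0) +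
    (\<Sum>i<x. G (h + x - i) i) + (\<Sum>j<h. G j x) + (\<Sum>i<x. G h i)"
  shows "of_nat (card (queen_paths_at h x)) = G h x"
proof (induction "h + 2 * x" arbitrary: h x rule: less_induct)
  case less
  have "of_nat (card (queen_paths_at h x)) =
      (if h = 0 \<and> x = 0 then 1 else 0) +
      (\<Sum>i<x. of_nat (card (queen_paths_at (h + x - i) i))) +
      (\<Sum>j<h. of_nat (card (queen_paths_at j x))) +
      (\<Sum>i<x. of_nat (card (queen_paths_at h i)) :: 'a)"
    by (subst card_queen_paths_at_rec) simp
  also have "\<dots> = G h x"
    unfolding assms[of h x]
    by (intro arg_cong2[of _ _ _ _ "(+)"] sum.cong refl less) auto
  finally show ?case .
qed

section \<open>Solving the recurrence\<close>

lemma fps_X_inverse_one_minus_X_nth: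
  fixes f :: "'a :: field fps"
  shows "(fps_X * inverse (1 - fps_X) * f) $ n = (\<Sum>i<n. f $ i)"
proof (cases n)
  case (Suc m)
  have "(fps_X * inverse (1 - fps_X) * f) $ n = (inverse (1 - fps_X) * f) $ m"
    by (simp add: Suc mult.assoc)
  also have "\<dots> = (\<Sum>i=0..m. f $ (m - i))"
    by (simp add: fps_mult_nth fps_inverse_one_minus_fps_X)
  also have "\<dots> = (\<Sum>i<n. f $ i)"
    by (subst sum.atLeastAtMost_rev) (auto simp: Suc lessThan_Suc_atMost atMost_atLeast0)
  finally show ?thesis .
qed (simp add: mult.assoc)

text \<open>Expand \<open>1 / (1 - t r)\<close> as a geometric series: the term
  \<open>f t^(k+1) r^k\<close> contributes the summand with \<open>i = n - k - 1\<close>. This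
  evaluates the sum over horizontal last steps.\<close>

lemma fps_shifted_geometric_sum:
  fixes f r :: "'a :: field fps"
  shows "(\<Sum>i<n. (f * r ^ (n - i - 1)) $ i) = (f * fps_X * inverse (1 - fps_X * r)) $ n"
proof (cases n)
  case (Suc m)
  define y where "y = fps_X * r"
  have unit: "(1 - y) * inverse (1 - y) = 1"
    by (intro inverse_mult_eq_1') (simp add: y_def)
  have "(\<Sum>i<n. (f * r ^ (n - i - 1)) $ i) = (\<Sum>i\<le>m. (f * r ^ (m - i)) $ i)"
    by (simp add: Suc lessThan_Suc_atMost)
  also have "\<dots> = (\<Sum>i\<le>m. (f * r ^ i) $ (m - i))"
    by (rule sum.reindex_bij_witness[of _ "\<lambda>i. m - i" "\<lambda>i. m - i"]) auto
  also have "\<dots> = (\<Sum>i\<le>m. (f * y ^ i) $ m)"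
  proof (intro sum.cong refl)
    fix i assume "i \<in> {..m}"
    have "f * y ^ i = fps_X ^ i * (f * r ^ i)"
      by (simp add: y_def power_mult_distrib mult_ac)
    then have "(f * y ^ i) $ m = (fps_X ^ i * (f * r ^ i)) $ m"
      by (rule arg_cong)
    with \<open>i \<in> {..m}\<close> show "(f * r ^ i) $ (m - i) = (f * y ^ i) $ m"
      by (simp add: fps_X_power_mult_nth)
  qed
  also have "\<dots> = (f * (\<Sum>i\<le>m. y ^ i)) $ m"
    by (simp add: sum_distrib_left fps_sum_nth)
  \<comment> \<open>The finite sum differs from \<open>inverse (1 - y)\<close> by a multiple of
    \<open>fps_X ^ Suc m\<close>, which does not reach coefficient \<open>m\<close>.\<close>
  also have "(\<Sum>i\<le>m. y ^ i) = ((1 - y) * (\<Sum>i\<le>m. y ^ i)) * inverse (1 - y)"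
    using unit by (simp only: mult.assoc mult.commute mult.left_commute) simp
  also have "(1 - y) * (\<Sum>i\<le>m. y ^ i) = 1 - fps_X ^ Suc m * r ^ Suc m"
    by (subst sum_gp_basic) (simp only: y_def power_mult_distrib)
  also have "f * ((1 - fps_X ^ Suc m * r ^ Suc m) * inverse (1 - y)) =
      f * inverse (1 - y) - fps_X ^ Suc m * (r ^ Suc m * f * inverse (1 - y))"
    by (simp only: algebra_simps mult_1_left)
  also have "\<dots> $ m = (f * inverse (1 - y)) $ m"
    by (simp only: fps_sub_nth fps_X_power_mult_nth) simp
  also have "\<dots> = (f * fps_X * inverse (1 - y)) $ n"
    by (simp add: Suc mult.assoc mult.left_commute[of f])
  finally show ?thesis by (simp add: y_def)
qed (simp add: mult.assoc)

text \<open>For \<open>h > 0\<close> this is the difference of \<open>P * r ^ h\<close> and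
  \<open>P * r ^ (h - 1)\<close>, so sums over consecutive heights from 0 telescope to a pure power
  of \<open>r\<close>.\<close>

definition height_series :: "'a :: field fps \<Rightarrow> 'a fps \<Rightarrow> nat \<Rightarrow> 'a fps" where
  "height_series P r h = (if h = 0 then P else P * (r - 1) * r ^ (h - 1))"

lemma sum_height_series: "(\<Sum>j<Suc h. height_series P r j) = P * r ^ h"
  by (induction h) (auto simp: height_series_def algebra_simps)

text \<open>With \<open>Q = 1/(1-t)\<close> and \<open>W = 1/(1-tr)\<close> the recurrence becomes
  one identity of power series for each \<open>h\<close>. For \<open>h > 0\<close> the factor
  \<open>P * r ^ (h - 1)\<close> splits off, and clearing denominators leaves the quadratic for
  \<open>r\<close>; for \<open>h = 0\<close> the relation between \<open>P\<close> and
  \<open>r\<close> leads to the same quadratic.\<close>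

lemma height_series_rec:
  fixes P r :: "'a :: field fps"
  assumes r: "fps_X * (2 - 3 * fps_X) * r ^ 2 - (1 + fps_X - 4 * fps_X ^ 2) * r
      + (2 - 3 * fps_X) = 0"
    and P: "P * (2 - 3 * fps_X) = r * (1 - fps_X)"
    and two: "(2 :: 'a) \<noteq> 0"
  shows "height_series P r h $ x = (if h = 0 \<and> x = 0 then 1 else 0) +
    (\<Sum>i<x. height_series P r (h + x - i) $ i) + (\<Sum>j<h. height_series P r j $ x) +
    (\<Sum>i<x. height_series P r h $ i)"
proof -
  let ?t = "fps_X :: 'a fps"
  define Q where "Q = inverse (1 - ?t)"
  define W where "W = inverse (1 - ?t * r)"
  have Q: "(1 - ?t) * Q = 1" and W: "(1 - ?t * r) * W = 1"
    unfolding Q_def W_def by (auto intro!: inverse_mult_eq_1')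
  have "(2 - 3 * ?t) $ 0 \<noteq> 0" using two by simp
  then have nz: "2 - 3 * ?t \<noteq> 0" by (metis fps_zero_nth)
  have unit: "(1 - ?t) * (1 - ?t * r) \<noteq> 0"
    using Q W by (metis mult_eq_0_iff zero_neq_one)
  have down: "(\<Sum>i<x. height_series P r (h + x - i) $ i) = (P * (r - 1) * r ^ h * ?t * W) $ x"
  proof -
    have "(\<Sum>i<x. height_series P r (h + x - i) $ i) =
        (\<Sum>i<x. (P * (r - 1) * r ^ h * r ^ (x - i - 1)) $ i)"
    proof (intro sum.cong refl)
      fix i assume "i \<in> {..<x}"
      \<comment> \<open>The source height is positive since \<open>i < x\<close>, so the second
        branch of \<open>height_series\<close> applies.\<close>
      then have "h + x - i = Suc (h + (x - i - 1))" by auto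
      then have "height_series P r (h + x - i) = P * (r - 1) * r ^ (h + (x - i - 1))"
        by (simp only: height_series_def diff_Suc_1 nat.simps if_False)
      then show "height_series P r (h + x - i) $ i =
          (P * (r - 1) * r ^ h * r ^ (x - i - 1)) $ i"
        by (simp only: power_add mult.assoc)
    qed
    then show ?thesis by (simp only: fps_shifted_geometric_sum W_def)
  qed
  have diag: "(\<Sum>i<x. height_series P r h $ i) = (?t * Q * height_series P r h) $ x"
    by (simp add: fps_X_inverse_one_minus_X_nth Q_def)
  have up: "(\<Sum>j<h. height_series P r j $ x) = (\<Sum>j<h. height_series P r j) $ x"
    by (simp add: fps_sum_nth)
  have start: "(if h = 0 \<and> x = 0 then 1 else 0) = (if h = 0 then 1 else 0 :: 'a fps) $ x"
    by auto
  have "height_series P r h = (if h = 0 then 1 else 0) + P * (r - 1) * r ^ h * ?t * W +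
      (\<Sum>j<h. height_series P r j) + ?t * Q * height_series P r h"
  proof (cases h)
    case 0
    \<comment> \<open>The factor \<open>2 - 3 * ?t\<close> allows \<open>P\<close> to be eliminated
      through its defining relation; it is cancelled afterwards.\<close>
    have "(2 - 3 * ?t) * ((1 - ?t) * (1 - ?t * r) * P) = (2 - 3 * ?t) *
        ((1 - ?t) * (1 - ?t * r) + (1 - ?t) * P * (r - 1) * ?t + (1 - ?t * r) * ?t * P)"
      using r P by algebra
    then have "(1 - ?t) * (1 - ?t * r) * P =
        (1 - ?t) * (1 - ?t * r) + (1 - ?t) * P * (r - 1) * ?t + (1 - ?t * r) * ?t * P"
      by (simp only: mult_left_cancel[OF nz])
    then have "P = 1 + P * (r - 1) * ?t * W + ?t * Q * P"
      using Q W by algebra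
    then show ?thesis by (simp add: 0 height_series_def)
  next
    case (Suc k)
    have "(1 - ?t) * (1 - ?t * r) * (r - 1) =
        (1 - ?t) * (r - 1) * r * ?t + (1 - ?t) * (1 - ?t * r) + (1 - ?t * r) * ?t * (r - 1)"
      using r by algebra
    also have "\<dots> = (1 - ?t) * (1 - ?t * r) * ((r - 1) * r * ?t * W + 1 + ?t * Q * (r - 1))"
      using Q W by algebra
    finally have "r - 1 = (r - 1) * r * ?t * W + 1 + ?t * Q * (r - 1)"
      by (simp only: mult_left_cancel[OF unit])
    then have "P * (r - 1) * r ^ k = P * ((r - 1) * r * ?t * W + 1 + ?t * Q * (r - 1)) * r ^ k"
      by metis
    then show ?thesis
      by (simp only: Suc sum_height_series) (simp add: height_series_def algebra_simps)
  qed
  then have "height_series P r h $ x = ((if h = 0 then 1 else 0) + P * (r - 1) * r ^ h * ?t * W +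
      (\<Sum>j<h. height_series P r j) + ?t * Q * height_series P r h) $ x"
    by (rule arg_cong)
  then show ?thesis
    by (simp only: down diag up start fps_add_nth)
qed

section \<open>The root \<open>r\<close> and the closed form\<close>

lemma P_queen_mult:
  "P_queen * (2 * fps_X * (2 - 3 * fps_X) ^ 2) =
    (1 - fps_X) * (1 + fps_X - 4 * fps_X ^ 2)
      - (1 - fps_X) ^ 2 * fps_sqrt (1 - 12 * fps_X + 16 * fps_X ^ 2)"
proof -
  let ?t = "fps_X :: real fps"
  define S where "S = fps_sqrt (1 - 12 * ?t + 16 * ?t ^ 2)"
  have S2: "S ^ 2 = 1 - 12 * ?t + 16 * ?t ^ 2" and S0: "S $ 0 = 1"
    unfolding S_def by (auto intro!: fps_sqrt_power2 fps_sqrt_nth_0)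
  define V where "V = inverse (2 - 3 * ?t)"
  have V: "(2 - 3 * ?t) * V = 1"
    unfolding V_def by (intro inverse_mult_eq_1') simp
  \<comment> \<open>The discriminant \<open>(1 + t - 4t^2)^2 - 4t(2 - 3t)^2\<close> of the quadratic
    equals \<open>(1 - t)^2 (1 - 12t + 16t^2)\<close>. The minus sign selects the root whose
    numerator has constant term 0, so that division by \<open>t\<close> stays within power
    series.\<close>
  define N where "N = (1 + ?t - 4 * ?t ^ 2) - (1 - ?t) * S"
  define M where "M = fps_shift 1 N"
  have "N $ 0 = 0" by (simp add: N_def S0)
  then have N: "N = ?t * M"
    unfolding M_def by (intro fps_ext) (auto simp: fps_X_mult_nth)
  define r where "r = fps_const (1 / 2) * M * V"
  define P where "P = r * (1 - ?t) * V"
  have half: "2 * fps_const (1 / 2 :: real) = 1"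
    by (simp add: fps_numeral_fps_const)
  have r2: "2 * ?t * (2 - 3 * ?t) * r = N"
    unfolding r_def N using V half by algebra
  have P: "P * (2 - 3 * ?t) = r * (1 - ?t)"
    unfolding P_def using V by algebra
  \<comment> \<open>Completing the square: with leading coefficient \<open>a = t(2 - 3t)\<close> and
    \<open>b = 1 + t - 4t^2\<close>, the square of \<open>2ar - b = -(1 - t) S\<close> is the
    discriminant.\<close>
  have "(4 * ?t * (2 - 3 * ?t)) * (?t * (2 - 3 * ?t) * r ^ 2 - (1 + ?t - 4 * ?t ^ 2) * r
      + (2 - 3 * ?t)) = 0"
    using r2 S2 unfolding N_def by algebra
  moreover have "4 * ?t * (2 - 3 * ?t) \<noteq> 0" using V by auto
  ultimately have r: "?t * (2 - 3 * ?t) * r ^ 2 - (1 + ?t - 4 * ?t ^ 2) * r + (2 - 3 * ?t) = 0"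
    by simp
  have "P_queen = P"
  proof (rule fps_ext)
    fix n
    have "P_queen $ n = of_nat (card (queen_paths_at 0 n))"
      by (simp add: P_queen_def p_queen_def catalan_queen_paths_def queen_paths_at_def)
    also have "\<dots> = height_series P r 0 $ n"
      by (rule card_queen_paths_at_unique[of "\<lambda>h. ($) (height_series P r h)"],
          rule height_series_rec[OF r P]) simp
    finally show "P_queen $ n = P $ n" by (simp add: height_series_def)
  qed
  moreover have "P * (2 * ?t * (2 - 3 * ?t) ^ 2) = (1 - ?t) * N"
    using P r2 by algebra
  ultimately show ?thesis
    unfolding S_def[symmetric] N_def by (simp add: algebra_simps power2_eq_square)
qed

theorem theorem3p3:
  shows "fps_to_fls P_queen =
    ((1 - fls_X) * (1 + fls_X - 4 * fls_X ^ 2)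
      - (1 - fls_X) ^ 2 * fps_to_fls (fps_sqrt (1 - 12 * fps_X + 16 * fps_X ^ 2)))
    / (2 * fls_X * (2 - 3 * fls_X) ^ 2)"
proof -
  \<comment> \<open>The denominator is divisible by \<open>t\<close>, so it is no unit among power
    series; in the field of Laurent series it only has to be nonzero.\<close>
  have "(2 - 3 * fps_X :: real fps) $ 0 \<noteq> 0"
    by simp
  then have "fps_to_fls (2 - 3 * fps_X :: real fps) \<noteq> 0"
    by (metis fps_to_fls_eq_0_iff fps_zero_nth)
  then have nz: "2 * fls_X * (2 - 3 * fls_X) ^ 2 \<noteq> (0 :: real fls)"
    by (simp add: fls_times_fps_to_fls)
  have "fps_to_fls (P_queen * (2 * fps_X * (2 - 3 * fps_X) ^ 2)) =
    fps_to_fls ((1 - fps_X) * (1 + fps_X - 4 * fps_X ^ 2)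
      - (1 - fps_X) ^ 2 * fps_sqrt (1 - 12 * fps_X + 16 * fps_X ^ 2))"
    by (rule arg_cong[OF P_queen_mult])
  then have "fps_to_fls P_queen * (2 * fls_X * (2 - 3 * fls_X) ^ 2) =
    (1 - fls_X) * (1 + fls_X - 4 * fls_X ^ 2)
      - (1 - fls_X) ^ 2 * fps_to_fls (fps_sqrt (1 - 12 * fps_X + 16 * fps_X ^ 2))"
    by (simp only: fls_times_fps_to_fls fps_to_fls_minus fps_to_fls_plus fps_to_fls_power
        fps_to_fls_numeral fps_X_to_fls fps_one_to_fls)
  with nz show ?thesis by (simp add: eq_divide_eq)
qed

end
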